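(* For any instance of the online congestion problem and any solution $x=(x_{ij})_{j\in N,i\in\mathcal S_j}$ obtained by the Greedy algorithm, there exists a feasible solution of (SDP-SR) with objective value at least $C(x)/4$. By weak duality, this implies that the competitive ratio of Greedy is at most $4$, i.e. $C(x)\le 4\,C(x^* )$ for every pure assignment $x^*$.
   Context: Congestion model. $N=\{1,\dots,n\}$ is the set of players and $E$ a finite set of resources. Each player $j\in N$ has a weight $w_j\ge 0$, a nonempty strategy set $\mathcal S_j\subseteq 2^E$, and processing times $p_{ej}\in[0,\infty]$ $(e\in E)$, with $p_{ej}<\infty$ whenever $e$ belongs to some strategy $i\in\mathcal S_j$. The Smith ratio is $\delta_{ej}=p_{ej}/w_j$, read as $+\infty$ if $w_j=0$. For each $e\in E$, $\prec_e$ is a strict total order on $N$ such that $k\prec_e j$ implies $\delta_{ek}\le\delta_{ej}$ (ties broken consistently). A pure assignment is $x=(x_{ij})$ with $x_{ij}\in\{0,1\}$ and $\sum_{i\in\mathcal S_j}x_{ij}=1$ for all $j$. Put $z_{ej}=\sum_{i\in\mathcal S_j:\,e\in i}x_{ij}$. Any term containing a factor $z_{ek}=0$ or a factor $w_k=0$ is read as $0$. The cost is $$C(x)=\sum_{e\in E}\sum_{j\in N}w_jp_{ej}z_{ej}+\sum_{e\in E}\sum_{j\in N,\,k\prec_e j}w_jp_{ek}z_{ek}z_{ej}.$$ Online problem. The players arrive one by one in the (adversarial) order $1,2,\dots,n$; on arrival $j$ reveals $\mathcal S_j$, $w_j$ and $(p_{ej})_{e}$, and the algorithm irrevocably chooses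 one $i\in\mathcal S_j$ (sets $x_{ij}=1$). $C^{(j)}(x)$ denotes the cost of the assignment restricted to players $1,\dots,j$, and $C^{(0)}(x)=0$. Greedy chooses, at the arrival of $j$, a strategy $i\in\mathcal S_j$ giving the minimal increase of the cost (minimal $C^{(j)}(x)-C^{(j-1)}(x)$), ties broken arbitrarily. The competitive ratio is the worst-case ratio over all instances between the cost of the algorithm and the cost of an optimal offline pure assignment. (SDP-SR): the variables are reals $y_j$ $(j\in N)$ and vectors $v_0, v_{ij}\in\mathbb R^d$ $(j\in N,i\in\mathcal S_j)$ for some $d\in\mathbb N$, with the standard inner product. Maximize $\sum_{j\in N}y_j-\frac12\|v_0\|^2$ subject to $y_j\le\sum_{e\in i}w_jp_{ej}-\frac12\|v_{ij}\|^2+\langle v_0,v_{ij}\rangle$ for all $j\in N,i\in\mathcal S_j$; and $\langle v_{ij},v_{i'k}\rangle\le\sum_{e\in i\cap i'}w_jw_k\min\{\delta_{ej},\delta_{ek}\}$ for all $(i,j)\ne(i',k)$ with $j,k\in N$, $i\in\mathcal S_j$, $i'\in\mathcal S_k$. *)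

theory Defs
  imports "HOL-Library.Extended_Real" "Jordan_Normal_Form.Matrix"
begin

text \<open>
  Processing times are extended reals. Throughout, \<open>0 * \<infinity> = 0\<close> in \<^typ>\<open>ereal\<close> implements the
  convention that a term with a factor \<open>z = 0\<close> or \<open>w = 0\<close> vanishes. The field \<open>prec e k j\<close>
  stands for \<open>k \<prec>\<^sub>e j\<close>; the numbering of the players is their order of arrival.
\<close>

record 'e congestion_instance =
  num_players :: nat
  resources :: "'e set"
  weight :: "nat \<Rightarrow> real"
  strategies :: "nat \<Rightarrow> 'e set set"
  ptime :: "'e \<Rightarrow> nat \<Rightarrow> ereal"
  prec :: "'e \<Rightarrow> nat \<Rightarrow> nat \<Rightarrow> bool"

definition players :: "'e congestion_instance \<Rightarrow> nat set" where
  "players I = {1..num_players I}"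

definition smith_ratio :: "'e congestion_instance \<Rightarrow> 'e \<Rightarrow> nat \<Rightarrow> ereal" where
  "smith_ratio I e j = (if weight I j = 0 then \<infinity> else ptime I e j / ereal (weight I j))"

definition valid_instance :: "'e congestion_instance \<Rightarrow> bool" where
  "valid_instance I \<longleftrightarrow>
     finite (resources I) \<and>
     (\<forall>j\<in>players I. 0 \<le> weight I j) \<and>
     (\<forall>j\<in>players I. strategies I j \<noteq> {} \<and> strategies I j \<subseteq> Pow (resources I)) \<and>
     (\<forall>e\<in>resources I. \<forall>j\<in>players I. 0 \<le> ptime I e j) \<and>
     (\<forall>j\<in>players I. \<forall>i\<in>strategies I j. \<forall>e\<in>i. ptime I e j < \<infinity>) \<and>
     (\<forall>e\<in>resources I.
        irreflp_on (players I) (prec I e) \<and>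
        transp_on (players I) (prec I e) \<and>
        totalp_on (players I) (prec I e) \<and>
        (\<forall>k\<in>players I. \<forall>j\<in>players I. prec I e k j \<longrightarrow> smith_ratio I e k \<le> smith_ratio I e j))"

text \<open>An assignment is a function with \<open>x i j\<close> the value \<open>x\<^sub>i\<^sub>j\<close> for a strategy \<open>i\<close> of player \<open>j\<close>;
  its values at other arguments are irrelevant.\<close>

definition pure_assignment :: "'e congestion_instance \<Rightarrow> ('e set \<Rightarrow> nat \<Rightarrow> real) \<Rightarrow> bool" where
  "pure_assignment I x \<longleftrightarrow>
     (\<forall>j\<in>players I. (\<forall>i\<in>strategies I j. x i j \<in> {0, 1}) \<and> (\<Sum>i\<in>strategies I j. x i j) = 1)"

definition load :: "'e congestion_instance \<Rightarrow> ('e set \<Rightarrow> nat \<Rightarrow> real) \<Rightarrow> 'e \<Rightarrow> nat \<Rightarrow> real" where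
  "load I x e j = (\<Sum>i\<in>{i \<in> strategies I j. e \<in> i}. x i j)"

text \<open>The cost \<open>C\<^sup>(\<^sup>m\<^sup>)(x)\<close> of the assignment restricted to the players \<open>1, \<dots>, m\<close>.\<close>

definition cost_upto :: "'e congestion_instance \<Rightarrow> nat \<Rightarrow> ('e set \<Rightarrow> nat \<Rightarrow> real) \<Rightarrow> ereal" where
  "cost_upto I m x =
     (\<Sum>e\<in>resources I. \<Sum>j\<in>{1..m}. ereal (weight I j) * ptime I e j * ereal (load I x e j)) +
     (\<Sum>e\<in>resources I. \<Sum>j\<in>{1..m}. \<Sum>k\<in>{k \<in> {1..m}. prec I e k j}.
        ereal (weight I j) * ptime I e k * ereal (load I x e k) * ereal (load I x e j))"

definition cost :: "'e congestion_instance \<Rightarrow> ('e set \<Rightarrow> nat \<Rightarrow> real) \<Rightarrow> ereal" where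
  "cost I x = cost_upto I (num_players I) x"

definition assign ::
  "('e set \<Rightarrow> nat \<Rightarrow> real) \<Rightarrow> nat \<Rightarrow> 'e set \<Rightarrow> 'e set \<Rightarrow> nat \<Rightarrow> real" where
  "assign x j i = (\<lambda>i' k. if k = j then (if i' = i then 1 else 0) else x i' k)"

text \<open>\<open>greedy I x\<close> says that \<open>x\<close> is a possible outcome of Greedy. Ties may be broken in any way,
  so there may be several. The cost increase compared at the arrival of \<open>j\<close> only depends on the
  choices of the players up to \<open>j\<close>.\<close>

definition greedy :: "'e congestion_instance \<Rightarrow> ('e set \<Rightarrow> nat \<Rightarrow> real) \<Rightarrow> bool" where
  "greedy I x \<longleftrightarrow> pure_assignment I x \<and>
     (\<forall>j\<in>players I. \<forall>i\<in>strategies I j. x i j = 1 \<longrightarrow>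
        is_arg_min (\<lambda>i'. cost_upto I j (assign x j i') - cost_upto I (j - 1) x)
          (\<lambda>i'. i' \<in> strategies I j) i)"

definition opt_cost :: "'e congestion_instance \<Rightarrow> ereal" where
  "opt_cost I = (INF x\<in>{x. pure_assignment I x}. cost I x)"

text \<open>In \<^typ>\<open>ereal\<close>, \<open>0 / 0 = 0\<close> and \<open>c / 0 = \<infinity>\<close> for \<open>c > 0\<close>, so an instance with optimum \<open>0\<close>
  leaves the ratio unaffected only if Greedy is optimal on it. The type argument fixes the type from
  which the finite sets of resources are drawn.\<close>

definition greedy_competitive_ratio :: "'e itself \<Rightarrow> ereal" where
  "greedy_competitive_ratio T =
     Sup {cost I x / opt_cost I | (I :: 'e congestion_instance) x. valid_instance I \<and> greedy I x}"

text \<open>Vectors in \<open>\<real>\<^sup>d\<close> are elements of \<^term>\<open>carrier_vec d\<close>, and \<open>\<parallel>u\<parallel>\<^sup>2\<close> is \<open>u \<bullet> u\<close>. All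
  processing times occurring here are finite on valid instances, and the minimum of the Smith ratios
  is infinite only if both weights are zero, in which case the summand is zero.\<close>

definition sdp_feasible ::
  "'e congestion_instance \<Rightarrow> nat \<Rightarrow> (nat \<Rightarrow> real) \<Rightarrow> real vec \<Rightarrow> ('e set \<Rightarrow> nat \<Rightarrow> real vec) \<Rightarrow> bool"
  where
  "sdp_feasible I d y v0 v \<longleftrightarrow>
     v0 \<in> carrier_vec d \<and>
     (\<forall>j\<in>players I. \<forall>i\<in>strategies I j. v i j \<in> carrier_vec d) \<and>
     (\<forall>j\<in>players I. \<forall>i\<in>strategies I j.
        ereal (y j) \<le> (\<Sum>e\<in>i. ereal (weight I j) * ptime I e j)
          - ereal (1/2 * (v i j \<bullet> v i j)) + ereal (v0 \<bullet> v i j)) \<and>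
     (\<forall>j\<in>players I. \<forall>k\<in>players I. \<forall>i\<in>strategies I j. \<forall>i'\<in>strategies I k. (i, j) \<noteq> (i', k) \<longrightarrow>
        ereal (v i j \<bullet> v i' k) \<le>
          (\<Sum>e\<in>i \<inter> i'. ereal (weight I j) * ereal (weight I k) *
             min (smith_ratio I e j) (smith_ratio I e k)))"

definition sdp_objective :: "'e congestion_instance \<Rightarrow> (nat \<Rightarrow> real) \<Rightarrow> real vec \<Rightarrow> real" where
  "sdp_objective I y v0 = (\<Sum>j\<in>players I. y j) - 1/2 * (v0 \<bullet> v0)"

end

theory Submission imports Defs begin

text \<open>
  The kernel \<open>min\<close> is the \<open>L\<^sup>2\<close> inner product of the indicators of intervals starting at \<open>0\<close>, so there are
  vectors \<open>f\<^sub>i\<^sub>j\<close> satisfying the inner product constraints of the semidefinite program with equality,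
  and \<open>\<parallel>f\<^sub>i\<^sub>j\<parallel>\<^sup>2\<close> is the cost of \<open>j\<close> playing \<open>i\<close> alone. Let \<open>F\<close> be the sum of the vectors
  selected by Greedy; then \<open>\<parallel>F\<parallel>\<^sup>2 \<le> 2 C(x)\<close>. Take \<open>v\<^sub>i\<^sub>j = f\<^sub>i\<^sub>j\<close>, \<open>v\<^sub>0 = F / 2\<close> and for \<open>y\<^sub>j\<close> half of the
  cost increase caused by \<open>j\<close>. Minimality of the increase is exactly dual feasibility, and the
  objective is \<open>C(x) / 2 - \<parallel>F\<parallel>\<^sup>2 / 8 \<ge> C(x) / 4\<close>. Weak duality is \<open>0 \<le> \<parallel>v\<^sub>0 - S\<parallel>\<^sup>2\<close> for \<open>S\<close> the sum of the
  vectors selected by the assignment compared with.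
\<close>

section \<open>Sums over pairs\<close>

text \<open>The double sum splits into its diagonal and two triangles, which are transposes of each
  other. The left side does not mention \<open>R\<close>, so any two strict total orders on
  \<open>A\<close> give the same triangle sum; this later allows trading \<open>prec\<close> for the
  order of arrival.\<close>

lemma sum_strict_total_order:
  fixes G :: "'a \<Rightarrow> 'a \<Rightarrow> real"
  assumes fin: "finite A"
    and R: "irreflp_on A R" "transp_on A R" "totalp_on A R"
    and sym: "\<And>j k. G j k = G k j"
  shows "(\<Sum>j\<in>A. \<Sum>k\<in>A. G j k) = (\<Sum>j\<in>A. G j j) + 2 * (\<Sum>j\<in>A. \<Sum>k\<in>{k \<in> A. R k j}. G j k)"
proof -
  have split: "(\<Sum>k\<in>A. G j k) =
      G j j + (\<Sum>k\<in>{k \<in> A. R k j}. G j k) + (\<Sum>k\<in>{k \<in> A. R j k}. G j k)" if "j \<in> A" for j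
  proof -
    have A: "A = insert j ({k \<in> A. R k j} \<union> {k \<in> A. R j k})"
      using R(3) that by (auto simp: totalp_on_def)
    have "j \<notin> {k \<in> A. R k j} \<union> {k \<in> A. R j k}"
      using R(1) that by (auto simp: irreflp_on_def)
    moreover have "{k \<in> A. R k j} \<inter> {k \<in> A. R j k} = {}"
      using R(1,2) that unfolding irreflp_on_def transp_on_def by blast
    ultimately have "sum (G j) (insert j ({k \<in> A. R k j} \<union> {k \<in> A. R j k})) =
        G j j + (sum (G j) {k \<in> A. R k j} + sum (G j) {k \<in> A. R j k})"
      using fin by (subst sum.insert) (auto intro!: sum.union_disjoint)
    then show ?thesis
      unfolding A[symmetric] by simp
  qed
  have "(\<Sum>j\<in>A. \<Sum>k\<in>{k \<in> A. R j k}. G j k) = (\<Sum>k\<in>A. \<Sum>j\<in>{j \<in> A. R j k}. G j k)"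
    by (rule sum.swap_restrict[OF fin fin])
  also have "\<dots> = (\<Sum>j\<in>A. \<Sum>k\<in>{k \<in> A. R k j}. G j k)"
    by (intro sum.cong refl sym)
  finally show ?thesis
    by (simp add: split sum.distrib)
qed

lemma sum_pairs_less:
  fixes G :: "nat \<Rightarrow> nat \<Rightarrow> real"
  assumes "\<And>j k. G j k = G k j"
  shows "(\<Sum>j\<in>{1..m}. \<Sum>k\<in>{1..m}. G j k) = (\<Sum>j\<in>{1..m}. G j j) + 2 * (\<Sum>j\<in>{1..m}. \<Sum>k\<in>{1..<j}. G j k)"
proof -
  have "{k \<in> {1..m}. k < j} = {1..<j}" if "j \<in> {1..m}" for j
    using that by auto
  then show ?thesis
    using sum_strict_total_order[of "{1..m}" "(<)" G] assms by simp
qed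

section \<open>Gram vectors of the minimum kernel\<close>

text \<open>The weight of \<open>t\<close> is its gap to the next smaller element of
  \<open>T\<close> (to \<open>0\<close> for the least one), so partial sums telescope. This is a
  discrete substitute for the length of an interval starting at \<open>0\<close>.\<close>

lemma telescoping_weights:
  fixes T :: "real set"
  assumes "finite T" "\<And>t. t \<in> T \<Longrightarrow> 0 \<le> t"
  shows "\<exists>g. (\<forall>t. 0 \<le> g t) \<and> (\<forall>s\<in>T. (\<Sum>t\<in>{t \<in> T. t \<le> s}. g t) = s)"
  using assms
proof (induction T rule: finite_linorder_max_induct)
  case empty
  then show ?case by (auto intro: exI[of _ "\<lambda>_. 0"])
next
  case (insert b A)
  then have "\<exists>g. (\<forall>t. 0 \<le> g t) \<and> (\<forall>s\<in>A. (\<Sum>t\<in>{t \<in> A. t \<le> s}. g t) = s)"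
    by simp
  then obtain g where g: "\<And>t. 0 \<le> g t" "\<And>s. s \<in> A \<Longrightarrow> (\<Sum>t\<in>{t \<in> A. t \<le> s}. g t) = s"
    by blast
  \<comment> \<open>The sum equals \<open>Max A\<close>, or \<open>0\<close> if \<open>A\<close> is
    empty. This makes the new weight \<open>b - sum g A\<close> nonnegative.\<close>
  have le: "sum g A \<le> b"
  proof (cases "A = {}")
    case False
    then have "{t \<in> A. t \<le> Max A} = A" "Max A \<in> A"
      using insert.hyps by auto
    then show ?thesis using g(2)[of "Max A"] insert.hyps by fastforce
  qed (use insert.prems in simp)
  let ?g = "g(b := b - sum g A)"
  have b: "b \<notin> A" using insert.hyps by auto
  have "(\<Sum>t\<in>{t \<in> insert b A. t \<le> s}. ?g t) = s" if "s \<in> insert b A" for s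
  proof (cases "s = b")
    case True
    then have "{t \<in> insert b A. t \<le> s} = insert b A" using insert.hyps by force
    moreover have "sum ?g A = sum g A" using b by (intro sum.cong) auto
    ultimately show ?thesis using True b insert.hyps by simp
  next
    case False
    then have "s \<in> A" using that by auto
    then have "{t \<in> insert b A. t \<le> s} = {t \<in> A. t \<le> s}" using insert.hyps by force
    moreover have "sum ?g {t \<in> A. t \<le> s} = sum g {t \<in> A. t \<le> s}" using b by (intro sum.cong) auto
    ultimately show ?thesis using g(2)[OF \<open>s \<in> A\<close>] by simp
  qed
  then show ?case using g(1) le by (intro exI[of _ ?g]) auto
qed

text \<open>Coordinates are pairs of a resource and a threshold \<open>t\<close>. Two entries are
  both nonzero only if \<open>e\<close> lies in both strategies and \<open>t\<close> is below both
  ratios, so the weights of the common thresholds add up to the minimum.\<close>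

lemma min_kernel_gram_vectors:
  fixes r :: "'e \<Rightarrow> 'a \<Rightarrow> real" and w :: "'a \<Rightarrow> real"
  assumes fin: "finite E" "finite N" and r: "\<And>e j. e \<in> E \<Longrightarrow> j \<in> N \<Longrightarrow> 0 \<le> r e j"
  shows "\<exists>d v. (\<forall>i j. v i j \<in> carrier_vec d) \<and>
    (\<forall>j\<in>N. \<forall>k\<in>N. \<forall>i i'. i \<subseteq> E \<longrightarrow> i' \<subseteq> E \<longrightarrow>
      v i j \<bullet> v i' k = (\<Sum>e\<in>i \<inter> i'. w j * w k * min (r e j) (r e k)))"
proof -
  define T where "T = case_prod r ` (E \<times> N)"
  have T: "finite T" "\<And>t. t \<in> T \<Longrightarrow> 0 \<le> t" "\<And>e j. e \<in> E \<Longrightarrow> j \<in> N \<Longrightarrow> r e j \<in> T"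
    using fin r by (auto simp: T_def)
  obtain g where g: "\<And>t. 0 \<le> g t" "\<And>s. s \<in> T \<Longrightarrow> (\<Sum>t\<in>{t \<in> T. t \<le> s}. g t) = s"
    using telescoping_weights[OF T(1,2)] by blast
  define d where "d = card (E \<times> T)"
  obtain h where h: "bij_betw h {0..<d} (E \<times> T)"
    using ex_bij_betw_nat_finite[of "E \<times> T"] fin T(1) unfolding d_def by auto
  define f :: "'e set \<Rightarrow> 'a \<Rightarrow> 'e \<times> real \<Rightarrow> real" where
    "f = (\<lambda>i j (e, t). if e \<in> i \<and> t \<le> r e j then w j * sqrt (g t) else 0)"
  define v where "v = (\<lambda>i j. vec d (\<lambda>n. f i j (h n)))"
  have "v i j \<bullet> v i' k = (\<Sum>e\<in>i \<inter> i'. w j * w k * min (r e j) (r e k))"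
    if jk: "j \<in> N" "k \<in> N" and i: "i \<subseteq> E" "i' \<subseteq> E" for i i' j k
  proof -
    have "v i j \<bullet> v i' k = (\<Sum>n\<in>{0..<d}. f i j (h n) * f i' k (h n))"
      by (simp add: v_def scalar_prod_def)
    also have "\<dots> = (\<Sum>p\<in>E \<times> T. f i j p * f i' k p)"
      by (rule sum.reindex_bij_betw[OF h])
    also have "\<dots> = (\<Sum>e\<in>E. \<Sum>t\<in>T. f i j (e, t) * f i' k (e, t))"
      by (simp add: sum.cartesian_product)
    also have "\<dots> = (\<Sum>e\<in>i \<inter> i'. \<Sum>t\<in>T. f i j (e, t) * f i' k (e, t))"
    proof (rule sum.mono_neutral_right)
      show "\<forall>e\<in>E - i \<inter> i'. (\<Sum>t\<in>T. f i j (e, t) * f i' k (e, t)) = 0"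
        by (auto simp: f_def intro!: sum.neutral split: if_splits)
    qed (use i fin(1) in auto)
    also have "\<dots> = (\<Sum>e\<in>i \<inter> i'. w j * w k * min (r e j) (r e k))"
    proof (rule sum.cong[OF refl])
      fix e assume e: "e \<in> i \<inter> i'"
      have "(\<Sum>t\<in>T. f i j (e, t) * f i' k (e, t)) =
          (\<Sum>t\<in>{t \<in> T. t \<le> min (r e j) (r e k)}. w j * w k * g t)"
        using e T(1) g(1) by (intro sum.mono_neutral_cong_right) (auto simp: f_def)
      \<comment> \<open>The minimum is one of the two ratios, hence an element of \<open>T\<close>,
        where the partial sum of \<open>g\<close> is known.\<close>
      also have "\<dots> = w j * w k * min (r e j) (r e k)"
        using e i jk T(3)[of e] g(2)[of "min (r e j) (r e k)"]
        by (auto simp: sum_distrib_left[symmetric] min_def split: if_splits)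
      finally show "(\<Sum>t\<in>T. f i j (e, t) * f i' k (e, t)) = w j * w k * min (r e j) (r e k)" .
    qed
    finally show ?thesis .
  qed
  moreover have "v i j \<in> carrier_vec d" for i j
    by (simp add: v_def)
  ultimately show ?thesis by blast
qed

section \<open>Sums and norms of vectors of a fixed dimension\<close>

definition vec_sum :: "nat \<Rightarrow> 'a set \<Rightarrow> ('a \<Rightarrow> real vec) \<Rightarrow> real vec" where
  "vec_sum d A a = vec d (\<lambda>n. \<Sum>j\<in>A. a j $ n)"

lemma vec_sum_carrier [simp]: "vec_sum d A a \<in> carrier_vec d"
  by (simp add: vec_sum_def)

lemma scalar_prod_vec_sum:
  assumes "u \<in> carrier_vec d" "\<And>j. j \<in> A \<Longrightarrow> a j \<in> carrier_vec d"
  shows "u \<bullet> vec_sum d A a = (\<Sum>j\<in>A. u \<bullet> a j)"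
proof -
  have "u \<bullet> vec_sum d A a = (\<Sum>n\<in>{0..<d}. \<Sum>j\<in>A. u $ n * a j $ n)"
    by (simp add: vec_sum_def scalar_prod_def sum_distrib_left)
  also have "\<dots> = (\<Sum>j\<in>A. \<Sum>n\<in>{0..<d}. u $ n * a j $ n)"
    by (rule sum.swap)
  also have "\<dots> = (\<Sum>j\<in>A. u \<bullet> a j)"
    using assms(2)[THEN carrier_vecD] by (intro sum.cong) (simp_all add: scalar_prod_def)
  finally show ?thesis .
qed

lemma vec_sum_scalar_prod:
  assumes "u \<in> carrier_vec d" "\<And>j. j \<in> A \<Longrightarrow> a j \<in> carrier_vec d"
  shows "vec_sum d A a \<bullet> u = (\<Sum>j\<in>A. a j \<bullet> u)"
proof -
  have "vec_sum d A a \<bullet> u = u \<bullet> vec_sum d A a"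
    using assms(1) by (intro comm_scalar_prod[of _ d]) auto
  also have "\<dots> = (\<Sum>j\<in>A. u \<bullet> a j)"
    by (rule scalar_prod_vec_sum[OF assms])
  also have "\<dots> = (\<Sum>j\<in>A. a j \<bullet> u)"
    using assms by (intro sum.cong refl comm_scalar_prod[of _ d]) auto
  finally show ?thesis .
qed

lemma vec_sum_norm:
  fixes a :: "nat \<Rightarrow> real vec"
  assumes "\<And>j. j \<in> {1..m} \<Longrightarrow> a j \<in> carrier_vec d"
  shows "vec_sum d {1..m} a \<bullet> vec_sum d {1..m} a =
    (\<Sum>j\<in>{1..m}. a j \<bullet> a j) + 2 * (\<Sum>j\<in>{1..m}. \<Sum>k\<in>{1..<j}. a j \<bullet> a k)"
proof -
  \<comment> \<open>Symmetry of the scalar product needs equal dimensions, known only for indices in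
    the range; extending by \<open>0\<close> gives the symmetry for all arguments that
    \<open>sum_pairs_less\<close> demands.\<close>
  let ?G = "\<lambda>j k :: nat. if j \<in> {1..m} \<and> k \<in> {1..m} then a j \<bullet> a k else 0"
  have sym: "?G j k = ?G k j" for j k
    using assms comm_scalar_prod[of "a j" d "a k"] by auto
  have "vec_sum d {1..m} a \<bullet> vec_sum d {1..m} a = (\<Sum>j\<in>{1..m}. \<Sum>k\<in>{1..m}. a j \<bullet> a k)"
    using assms by (subst vec_sum_scalar_prod[where d = d]) (auto intro!: sum.cong scalar_prod_vec_sum)
  also have "\<dots> = (\<Sum>j\<in>{1..m}. \<Sum>k\<in>{1..m}. ?G j k)"
    by simp
  also have "\<dots> = (\<Sum>j\<in>{1..m}. ?G j j) + 2 * (\<Sum>j\<in>{1..m}. \<Sum>k\<in>{1..<j}. ?G j k)"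
    by (rule sum_pairs_less[where G = ?G, OF sym])
  also have "\<dots> = (\<Sum>j\<in>{1..m}. a j \<bullet> a j) + 2 * (\<Sum>j\<in>{1..m}. \<Sum>k\<in>{1..<j}. a j \<bullet> a k)"
    by (intro arg_cong2[where f = "(+)"] arg_cong2[where f = "(*)"] refl sum.cong) auto
  finally show ?thesis .
qed

lemma scalar_prod_le_norms:
  fixes u v :: "real vec"
  assumes "u \<in> carrier_vec d" "v \<in> carrier_vec d"
  shows "2 * (u \<bullet> v) \<le> u \<bullet> u + v \<bullet> v"
proof -
  have "0 \<le> (\<Sum>n\<in>{0..<d}. (u $ n - v $ n)\<^sup>2)"
    by (simp add: sum_nonneg)
  also have "\<dots> = u \<bullet> u + v \<bullet> v - 2 * (u \<bullet> v)"
    using assms by (simp add: scalar_prod_def power2_diff sum.distrib sum_subtractf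
        sum_distrib_left mult.assoc flip: power2_eq_square)
  finally show ?thesis by simp
qed

section \<open>Real-valued costs\<close>

text \<open>An infinite time becomes \<open>0\<close>. On a valid instance the value is therefore
  nonnegative throughout, but faithful to \<open>ptime\<close> only where the time is finite, in
  particular on the strategies of the player.\<close>

definition rtime :: "'e congestion_instance \<Rightarrow> 'e \<Rightarrow> nat \<Rightarrow> real" where
  "rtime I e j = real_of_ereal (ptime I e j)"

definition own_cost :: "'e congestion_instance \<Rightarrow> nat \<Rightarrow> 'e set \<Rightarrow> real" where
  "own_cost I j i = (\<Sum>e\<in>i. weight I j * rtime I e j)"

text \<open>For weight \<open>0\<close> the ratio \<open>rtime / weight\<close> is the junk value \<open>0\<close> instead of \<open>\<infinity>\<close>, which is harmless
  since the minimum is multiplied by the weight.\<close>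

definition pair_cost :: "'e congestion_instance \<Rightarrow> nat \<Rightarrow> nat \<Rightarrow> 'e set \<Rightarrow> 'e set \<Rightarrow> real" where
  "pair_cost I j k i i' = (\<Sum>e\<in>i \<inter> i'.
     weight I j * weight I k * min (rtime I e j / weight I j) (rtime I e k / weight I k))"

text \<open>Interactions are charged to the player arriving later, not to the one that comes later
  in \<open>prec\<close>. Only the values of \<open>s\<close> below \<open>j\<close> matter.\<close>

definition marginal_cost :: "'e congestion_instance \<Rightarrow> (nat \<Rightarrow> 'e set) \<Rightarrow> nat \<Rightarrow> 'e set \<Rightarrow> real" where
  "marginal_cost I s j i = own_cost I j i + (\<Sum>k\<in>{1..<j}. pair_cost I j k i (s k))"

definition chooses ::
  "'e congestion_instance \<Rightarrow> nat \<Rightarrow> (nat \<Rightarrow> 'e set) \<Rightarrow> ('e set \<Rightarrow> nat \<Rightarrow> real) \<Rightarrow> bool" where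
  "chooses I m s x \<longleftrightarrow>
     (\<forall>j\<in>{1..m}. s j \<in> strategies I j \<and> (\<forall>i\<in>strategies I j. x i j = of_bool (i = s j)))"

lemma valid_instanceD:
  assumes "valid_instance I"
  shows "finite (resources I)"
    and "j \<in> players I \<Longrightarrow> 0 \<le> weight I j"
    and "j \<in> players I \<Longrightarrow> i \<in> strategies I j \<Longrightarrow> i \<subseteq> resources I"
    and "j \<in> players I \<Longrightarrow> i \<in> strategies I j \<Longrightarrow> finite i"
    and "j \<in> players I \<Longrightarrow> finite (strategies I j)"
    and "e \<in> resources I \<Longrightarrow> j \<in> players I \<Longrightarrow> 0 \<le> rtime I e j"
    and "j \<in> players I \<Longrightarrow> i \<in> strategies I j \<Longrightarrow> e \<in> i \<Longrightarrow> ptime I e j = ereal (rtime I e j)"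
proof -
  show fin: "finite (resources I)"
    using assms by (simp add: valid_instance_def)
  have sub: "i \<subseteq> resources I" if "j \<in> players I" "i \<in> strategies I j" for i j
    using assms that by (auto simp: valid_instance_def)
  show "j \<in> players I \<Longrightarrow> i \<in> strategies I j \<Longrightarrow> i \<subseteq> resources I"
    by (rule sub)
  show "j \<in> players I \<Longrightarrow> 0 \<le> weight I j"
    using assms by (simp add: valid_instance_def)
  show "j \<in> players I \<Longrightarrow> finite (strategies I j)"
    using assms fin by (auto simp: valid_instance_def intro: finite_subset)
  show "j \<in> players I \<Longrightarrow> i \<in> strategies I j \<Longrightarrow> finite i"
    using fin sub finite_subset by blast
  show "e \<in> resources I \<Longrightarrow> j \<in> players I \<Longrightarrow> 0 \<le> rtime I e j"
    using assms by (auto simp: valid_instance_def rtime_def intro: real_of_ereal_pos)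
  show "ptime I e j = ereal (rtime I e j)" if "j \<in> players I" "i \<in> strategies I j" "e \<in> i"
  proof -
    have "e \<in> resources I" using sub that by blast
    then have "0 \<le> ptime I e j" "ptime I e j < \<infinity>"
      using assms that by (auto simp: valid_instance_def)
    then show ?thesis by (cases "ptime I e j") (auto simp: rtime_def)
  qed
qed

lemma own_cost_ereal:
  assumes "valid_instance I" "j \<in> players I" "i \<in> strategies I j"
  shows "(\<Sum>e\<in>i. ereal (weight I j) * ptime I e j) = ereal (own_cost I j i)"
  using valid_instanceD(7)[OF assms] by (simp add: own_cost_def)

text \<open>The diagonal of the kernel: one factor \<open>weight\<close> cancels the division, and
  for weight \<open>0\<close> both sides vanish. Hence the Gram vectors have squared norm
  \<open>own_cost\<close>.\<close>

lemma own_cost_eq_pair_cost: "own_cost I j i = pair_cost I j j i i"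
  by (auto simp: own_cost_def pair_cost_def intro!: sum.cong)

lemma pair_cost_commute: "pair_cost I j k i i' = pair_cost I k j i' i"
  by (simp add: pair_cost_def Int_commute mult.commute min.commute)

lemma pair_cost_nonneg:
  assumes "valid_instance I" "j \<in> players I" "k \<in> players I" "i \<in> strategies I j" "i' \<in> strategies I k"
  shows "0 \<le> pair_cost I j k i i'"
  unfolding pair_cost_def
proof (rule sum_nonneg)
  fix e assume "e \<in> i \<inter> i'"
  then have "e \<in> resources I" using valid_instanceD(3)[OF assms(1,2,4)] by auto
  then show "0 \<le> weight I j * weight I k * min (rtime I e j / weight I j) (rtime I e k / weight I k)"
    using valid_instanceD(2,6)[OF assms(1)] assms(2,3) by simp
qed

lemma own_cost_nonneg:
  assumes "valid_instance I" "j \<in> players I" "i \<in> strategies I j"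
  shows "0 \<le> own_cost I j i"
  using pair_cost_nonneg[OF assms(1) assms(2,2) assms(3,3)] by (simp add: own_cost_eq_pair_cost)

text \<open>For nonzero weights the Smith ratios are the real quotients. If a weight is zero, both
  sides vanish, even where the minimum is infinite.\<close>

lemma pair_cost_ereal:
  assumes "valid_instance I" "j \<in> players I" "k \<in> players I" "i \<in> strategies I j" "i' \<in> strategies I k"
  shows "(\<Sum>e\<in>i \<inter> i'. ereal (weight I j) * ereal (weight I k) *
      min (smith_ratio I e j) (smith_ratio I e k)) = ereal (pair_cost I j k i i')"
proof -
  have "ereal (weight I j) * ereal (weight I k) * min (smith_ratio I e j) (smith_ratio I e k) =
      ereal (weight I j * weight I k * min (rtime I e j / weight I j) (rtime I e k / weight I k))"
    if "e \<in> i \<inter> i'" for e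
    using that valid_instanceD(7)[OF assms(1) assms(2,4), of e]
      valid_instanceD(7)[OF assms(1) assms(3,5), of e]
    by (auto simp: smith_ratio_def min_def)
  then show ?thesis by (simp add: pair_cost_def)
qed

section \<open>From assignments to selected strategies\<close>

lemma pure_assignment_chooses:
  assumes "valid_instance I" "pure_assignment I x"
  shows "\<exists>s. chooses I (num_players I) s x"
proof -
  have "\<exists>t. t \<in> strategies I j \<and> (\<forall>i\<in>strategies I j. x i j = of_bool (i = t))" if j: "j \<in> players I" for j
  proof -
    have fin: "finite (strategies I j)" using valid_instanceD(5)[OF assms(1) j] .
    have x: "\<forall>i\<in>strategies I j. x i j \<in> {0, 1}" "(\<Sum>i\<in>strategies I j. x i j) = 1"
      using assms(2) j by (auto simp: pure_assignment_def)
    \<comment> \<open>With entries in \<open>{0, 1}\<close> the sum counts the ones, so exactly one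
      strategy is selected.\<close>
    have "(\<Sum>i\<in>strategies I j. x i j) = (\<Sum>i\<in>{i \<in> strategies I j. x i j = 1}. 1)"
      using x(1) fin by (intro sum.mono_neutral_cong_right) auto
    then have "card {i \<in> strategies I j. x i j = 1} = 1" using x(2) by simp
    then obtain t where "{i \<in> strategies I j. x i j = 1} = {t}" by (auto simp: card_1_singleton_iff)
    then show ?thesis using x(1) by (intro exI[of _ t]) auto
  qed
  then have "\<exists>s. \<forall>j\<in>players I. s j \<in> strategies I j \<and> (\<forall>i\<in>strategies I j. x i j = of_bool (i = s j))"
    by metis
  then show ?thesis by (simp add: chooses_def players_def)
qed

lemma load_chooses:
  assumes "valid_instance I" "chooses I m s x" "m \<le> num_players I" "j \<in> {1..m}"
  shows "load I x e j = of_bool (e \<in> s j)"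
proof -
  have fin: "finite (strategies I j)"
    using valid_instanceD(5)[OF assms(1), of j] assms(3,4) by (simp add: players_def)
  have s: "s j \<in> strategies I j" using assms(2,4) by (simp add: chooses_def)
  have "load I x e j = (\<Sum>i\<in>{i \<in> strategies I j. e \<in> i}. if i = s j then 1 else 0)"
    unfolding load_def using assms(2,4) by (intro sum.cong) (auto simp: chooses_def)
  also have "\<dots> = of_bool (e \<in> s j)"
    using fin s by (simp add: sum.delta)
  finally show ?thesis .
qed

text \<open>If \<open>k\<close> precedes \<open>j\<close> in \<open>prec I e\<close>, then
  \<open>k\<close> has the smaller Smith ratio and the interaction term is the minimum kernel, which
  is symmetric in the players. On each resource the pairs can thus be summed by arrival instead, and
  the cost becomes a sum of increments.\<close>

lemma cost_upto_chooses:
  assumes I: "valid_instance I" and ch: "chooses I m s x" and m: "m \<le> num_players I"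
  shows "cost_upto I m x = ereal (\<Sum>j\<in>{1..m}. marginal_cost I s j (s j))"
proof -
  let ?E = "resources I"
  let ?D = "\<lambda>e j. rtime I e j / weight I j"
  let ?G = "\<lambda>e j k. of_bool (e \<in> s j \<inter> s k) * (weight I j * weight I k * min (?D e j) (?D e k))"
  have pl: "j \<in> players I" and s: "s j \<in> strategies I j" if "j \<in> {1..m}" for j
    using that m ch by (auto simp: players_def chooses_def)
  have sE: "s j \<subseteq> ?E" if "j \<in> {1..m}" for j
    using valid_instanceD(3)[OF I pl s] that by blast
  have finE: "finite ?E" using valid_instanceD(1)[OF I] .
  have pt: "ptime I e j = ereal (rtime I e j)" if "j \<in> {1..m}" "e \<in> s j" for e j
    using valid_instanceD(7)[OF I pl s] that by blast
  note load = load_chooses[OF I ch m]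
  have own: "(\<Sum>e\<in>?E. \<Sum>j\<in>{1..m}. ereal (weight I j) * ptime I e j * ereal (load I x e j)) =
      ereal (\<Sum>j\<in>{1..m}. own_cost I j (s j))"
  proof -
    have "ereal (weight I j) * ptime I e j * ereal (load I x e j) =
        ereal (of_bool (e \<in> s j) * (weight I j * rtime I e j))" if "j \<in> {1..m}" for e j
      using load[OF that, of e] pt[OF that, of e] by (simp add: zero_ereal_def[symmetric])
    then have "(\<Sum>e\<in>?E. \<Sum>j\<in>{1..m}. ereal (weight I j) * ptime I e j * ereal (load I x e j)) =
        ereal (\<Sum>e\<in>?E. \<Sum>j\<in>{1..m}. of_bool (e \<in> s j) * (weight I j * rtime I e j))"
      by simp
    also have "(\<Sum>e\<in>?E. \<Sum>j\<in>{1..m}. of_bool (e \<in> s j) * (weight I j * rtime I e j)) =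
        (\<Sum>j\<in>{1..m}. \<Sum>e\<in>?E. of_bool (e \<in> s j) * (weight I j * rtime I e j))"
      by (rule sum.swap)
    also have "\<dots> = (\<Sum>j\<in>{1..m}. own_cost I j (s j))"
      unfolding own_cost_def using sE finE
      by (intro sum.cong refl sum.mono_neutral_cong_right) auto
    finally show ?thesis .
  qed
  have pair: "ereal (weight I j) * ptime I e k * ereal (load I x e k) * ereal (load I x e j) =
      ereal (?G e j k)" if e: "e \<in> ?E" and jk: "j \<in> {1..m}" "k \<in> {1..m}" "prec I e k j" for e j k
  proof (cases "e \<in> s j \<inter> s k")
    \<comment> \<open>One of the two loads is \<open>0\<close>, which annihilates the product even
      if \<open>ptime I e k\<close> is infinite.\<close>
    case False
    then show ?thesis using load[OF jk(1), of e] load[OF jk(2), of e]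
      by (auto simp: zero_ereal_def[symmetric])
  next
    case True
    have le: "smith_ratio I e k \<le> smith_ratio I e j"
      using I e jk pl by (auto simp: valid_instance_def)
    have "weight I j * rtime I e k = weight I j * weight I k * min (?D e j) (?D e k)"
    proof (cases "weight I j = 0")
      \<comment> \<open>Since \<open>e\<close> is in \<open>s j\<close>, the ratio of
        \<open>j\<close> is finite. The smaller ratio of \<open>k\<close> is then finite as well,
        which excludes weight \<open>0\<close> for \<open>k\<close>.\<close>
      case False
      then have "weight I k \<noteq> 0" "?D e k \<le> ?D e j"
        using le pt[OF jk(1), of e] pt[OF jk(2), of e] True
        by (auto simp: smith_ratio_def split: if_splits)
      then show ?thesis by (simp add: min.absorb2)
    qed simp
    then show ?thesis using True load[OF jk(1), of e] load[OF jk(2), of e] pt[OF jk(2), of e]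
      by simp
  qed
  \<comment> \<open>Both sides are half of the off-diagonal part of the same symmetric double
    sum.\<close>
  have reorder: "(\<Sum>j\<in>{1..m}. \<Sum>k\<in>{k \<in> {1..m}. prec I e k j}. ?G e j k) =
      (\<Sum>j\<in>{1..m}. \<Sum>k\<in>{1..<j}. ?G e j k)" if e: "e \<in> ?E" for e
  proof -
    have sub: "{1..m} \<subseteq> players I" using pl by blast
    have "irreflp_on (players I) (prec I e)" "transp_on (players I) (prec I e)"
      "totalp_on (players I) (prec I e)"
      using I e by (auto simp: valid_instance_def)
    then have "irreflp_on {1..m} (prec I e)" "transp_on {1..m} (prec I e)" "totalp_on {1..m} (prec I e)"
      using sub by (auto intro: irreflp_on_subset transp_on_subset totalp_on_subset)
    moreover have sym: "?G e j k = ?G e k j" for j k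
      by (auto simp: min.commute)
    ultimately show ?thesis
      using sum_strict_total_order[of "{1..m}" "prec I e" "?G e"] sum_pairs_less[of "?G e" m] by simp
  qed
  have "(\<Sum>e\<in>?E. \<Sum>j\<in>{1..m}. \<Sum>k\<in>{k \<in> {1..m}. prec I e k j}.
        ereal (weight I j) * ptime I e k * ereal (load I x e k) * ereal (load I x e j)) =
      (\<Sum>e\<in>?E. \<Sum>j\<in>{1..m}. \<Sum>k\<in>{k \<in> {1..m}. prec I e k j}. ereal (?G e j k))"
    by (intro sum.cong refl pair) auto
  also have "\<dots> = ereal (\<Sum>e\<in>?E. \<Sum>j\<in>{1..m}. \<Sum>k\<in>{k \<in> {1..m}. prec I e k j}. ?G e j k)"
    by (simp only: sum_ereal)
  also have "(\<Sum>e\<in>?E. \<Sum>j\<in>{1..m}. \<Sum>k\<in>{k \<in> {1..m}. prec I e k j}. ?G e j k) =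
      (\<Sum>e\<in>?E. \<Sum>j\<in>{1..m}. \<Sum>k\<in>{1..<j}. ?G e j k)"
    by (intro sum.cong refl reorder)
  also have "\<dots> = (\<Sum>j\<in>{1..m}. \<Sum>e\<in>?E. \<Sum>k\<in>{1..<j}. ?G e j k)"
    by (rule sum.swap)
  also have "\<dots> = (\<Sum>j\<in>{1..m}. \<Sum>k\<in>{1..<j}. \<Sum>e\<in>?E. ?G e j k)"
    by (intro sum.cong refl sum.swap)
  also have "\<dots> = (\<Sum>j\<in>{1..m}. \<Sum>k\<in>{1..<j}. pair_cost I j k (s j) (s k))"
  proof (intro sum.cong refl)
    fix j k assume "j \<in> {1..m}" "k \<in> {1..<j}"
    then have "s j \<inter> s k \<subseteq> ?E" using sE[of j] by auto
    then show "(\<Sum>e\<in>?E. ?G e j k) = pair_cost I j k (s j) (s k)"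
      unfolding pair_cost_def using finE by (intro sum.mono_neutral_cong_right) auto
  qed
  finally show ?thesis
    unfolding cost_upto_def own by (simp add: marginal_cost_def sum.distrib)
qed

section \<open>Weak duality\<close>

text \<open>Add the constraints on \<open>y\<close> for the selected strategies and bound the inner
  product of \<open>v0\<close> and \<open>?S\<close> by half the sum of their squared norms. In the
  expansion of the squared norm of \<open>?S\<close> the diagonal cancels against the subtracted
  squared norms; the off-diagonal products are bounded by \<open>pair_cost\<close>.\<close>

lemma sdp_weak_duality:
  assumes I: "valid_instance I" and feas: "sdp_feasible I d y v0 v" and x: "pure_assignment I x"
  shows "ereal (sdp_objective I y v0) \<le> cost I x"
proof -
  let ?n = "num_players I"
  obtain s where ch: "chooses I ?n s x"
    using pure_assignment_chooses[OF I x] by blast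
  have pl: "players I = {1..?n}" by (simp add: players_def)
  have s: "s j \<in> strategies I j" if "j \<in> players I" for j
    using ch that by (simp add: chooses_def players_def)
  define a where "a j = v (s j) j" for j
  let ?S = "vec_sum d {1..?n} a"
  have a: "a j \<in> carrier_vec d" if "j \<in> {1..?n}" for j
    using feas s that by (auto simp: sdp_feasible_def a_def pl)
  have v0: "v0 \<in> carrier_vec d" using feas by (simp add: sdp_feasible_def)
  have y: "y j \<le> own_cost I j (s j) - 1/2 * (a j \<bullet> a j) + v0 \<bullet> a j" if "j \<in> players I" for j
  proof -
    have "ereal (y j) \<le> (\<Sum>e\<in>s j. ereal (weight I j) * ptime I e j)
          - ereal (1/2 * (a j \<bullet> a j)) + ereal (v0 \<bullet> a j)"
      using feas s[OF that] that unfolding sdp_feasible_def a_def by blast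
    then show ?thesis by (simp add: own_cost_ereal[OF I that s[OF that]])
  qed
  have pair: "a j \<bullet> a k \<le> pair_cost I j k (s j) (s k)"
    if "j \<in> players I" "k \<in> players I" "j \<noteq> k" for j k
  proof -
    have "ereal (a j \<bullet> a k) \<le> (\<Sum>e\<in>s j \<inter> s k. ereal (weight I j) * ereal (weight I k) *
             min (smith_ratio I e j) (smith_ratio I e k))"
      using feas s that unfolding sdp_feasible_def a_def by blast
    then show ?thesis using pair_cost_ereal[OF I that(1,2) s s] that by simp
  qed
  have "(\<Sum>j\<in>{1..?n}. y j) \<le> (\<Sum>j\<in>{1..?n}. own_cost I j (s j) - 1/2 * (a j \<bullet> a j) + v0 \<bullet> a j)"
    by (intro sum_mono y) (simp add: pl)
  also have "\<dots> = (\<Sum>j\<in>{1..?n}. own_cost I j (s j)) - 1/2 * (\<Sum>j\<in>{1..?n}. a j \<bullet> a j) + v0 \<bullet> ?S"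
    using scalar_prod_vec_sum[of v0 d "{1..?n}" a, OF v0 a] by (simp add: sum.distrib sum_subtractf sum_distrib_left)
  finally have 1: "(\<Sum>j\<in>{1..?n}. y j) \<le>
      (\<Sum>j\<in>{1..?n}. own_cost I j (s j)) - 1/2 * (\<Sum>j\<in>{1..?n}. a j \<bullet> a j) + v0 \<bullet> ?S" .
  have 2: "2 * (v0 \<bullet> ?S) \<le> v0 \<bullet> v0 + ?S \<bullet> ?S"
    using scalar_prod_le_norms[OF v0] by simp
  have 3: "?S \<bullet> ?S = (\<Sum>j\<in>{1..?n}. a j \<bullet> a j) + 2 * (\<Sum>j\<in>{1..?n}. \<Sum>k\<in>{1..<j}. a j \<bullet> a k)"
    using a by (rule vec_sum_norm)
  have 4: "(\<Sum>j\<in>{1..?n}. \<Sum>k\<in>{1..<j}. a j \<bullet> a k) \<le>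
      (\<Sum>j\<in>{1..?n}. \<Sum>k\<in>{1..<j}. pair_cost I j k (s j) (s k))"
    by (intro sum_mono pair) (auto simp: pl)
  have "sdp_objective I y v0 \<le> (\<Sum>j\<in>{1..?n}. marginal_cost I s j (s j))"
    using 1 2 3 4 by (simp add: sdp_objective_def marginal_cost_def sum.distrib pl)
  then show ?thesis
    by (simp add: cost_def cost_upto_chooses[OF I ch])
qed

section \<open>Dual fitting for Greedy\<close>

text \<open>By \<open>cost_upto_chooses\<close> the increments compared by Greedy are differences of
  two sums that agree on all earlier players, so only the marginal cost of \<open>j\<close>
  remains.\<close>

lemma greedy_marginal_cost_le:
  assumes I: "valid_instance I" and gr: "greedy I x" and ch: "chooses I (num_players I) s x"
    and j: "j \<in> players I" and i: "i \<in> strategies I j"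
  shows "marginal_cost I s j (s j) \<le> marginal_cost I s j i"
proof -
  have j': "1 \<le> j" "j \<le> num_players I" using j by (auto simp: players_def)
  have sj: "s j \<in> strategies I j" using ch j by (simp add: chooses_def players_def)
  have inc: "cost_upto I j (assign x j i') - cost_upto I (j - 1) x = ereal (marginal_cost I s j i')"
    if "i' \<in> strategies I j" for i'
  proof -
    let ?s = "s(j := i')"
    have ch1: "chooses I j ?s (assign x j i')" and ch2: "chooses I (j - 1) s x"
      using ch that j' by (auto simp: chooses_def assign_def)
    have "{1..j} = insert j {1..j - 1}" using j' by auto
    then have "(\<Sum>k\<in>{1..j}. marginal_cost I ?s k (?s k)) =
        marginal_cost I ?s j (?s j) + (\<Sum>k\<in>{1..j - 1}. marginal_cost I ?s k (?s k))"
      using j' by simp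
    also have "(\<Sum>k\<in>{1..j - 1}. marginal_cost I ?s k (?s k)) =
        (\<Sum>k\<in>{1..j - 1}. marginal_cost I s k (s k))"
      using j' by (intro sum.cong refl) (auto simp: marginal_cost_def intro!: sum.cong)
    also have "marginal_cost I ?s j (?s j) = marginal_cost I s j i'"
      by (simp add: marginal_cost_def)
    finally show ?thesis
      using cost_upto_chooses[OF I ch1] cost_upto_chooses[OF I ch2] j' by (simp del: fun_upd_apply)
  qed
  have "x (s j) j = 1" using ch j sj by (simp add: chooses_def players_def)
  then have "is_arg_min (\<lambda>i'. cost_upto I j (assign x j i') - cost_upto I (j - 1) x)
      (\<lambda>i'. i' \<in> strategies I j) (s j)"
    using gr j sj unfolding greedy_def by blast
  then have "\<not> ereal (marginal_cost I s j i) < ereal (marginal_cost I s j (s j))"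
    using i unfolding is_arg_min_def inc[OF i, symmetric] inc[OF sj, symmetric] by blast
  then show ?thesis by simp
qed

lemma greedy_dual_solution:
  assumes I: "valid_instance I" and gr: "greedy I x"
  shows "\<exists>d y v0 v. sdp_feasible I d y v0 v \<and> cost I x / 4 \<le> ereal (sdp_objective I y v0)"
proof -
  let ?n = "num_players I"
  obtain s where ch: "chooses I ?n s x"
    using pure_assignment_chooses[OF I, of x] gr unfolding greedy_def by blast
  have pl: "players I = {1..?n}" by (simp add: players_def)
  have s: "s j \<in> strategies I j" if "j \<in> players I" for j
    using ch that by (simp add: chooses_def players_def)
  have fin: "finite (resources I)" "finite (players I)"
    using valid_instanceD(1)[OF I] by (simp_all add: pl)
  have nonneg: "0 \<le> rtime I e j / weight I j" if "e \<in> resources I" "j \<in> players I" for e j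
    using valid_instanceD(2,6)[OF I] that by simp
  obtain d v where v: "\<And>i j. v i j \<in> carrier_vec d" and
    gram: "\<forall>j\<in>players I. \<forall>k\<in>players I. \<forall>i i'. i \<subseteq> resources I \<longrightarrow> i' \<subseteq> resources I \<longrightarrow>
      v i j \<bullet> v i' k = pair_cost I j k i i'"
    using min_kernel_gram_vectors[where r = "\<lambda>e j. rtime I e j / weight I j", OF fin nonneg,
        of "weight I", folded pair_cost_def]
    by blast
  have ip: "v i j \<bullet> v i' k = pair_cost I j k i i'"
    if "j \<in> players I" "k \<in> players I" "i \<in> strategies I j" "i' \<in> strategies I k" for i i' j k
    using gram that valid_instanceD(3)[OF I] by blast
  define F where "F = vec_sum d {1..?n} (\<lambda>j. v (s j) j)"
  \<comment> \<open>With a common factor \<alpha> for \<open>v0\<close> and \<open>y\<close>,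
    feasibility of the own cost term needs \<alpha> at most \<open>1/2\<close>, and the objective is
    at least \<alpha> - \<alpha>^2 times the cost. The value \<open>1/2\<close> is optimal for
    both.\<close>
  define v0 where "v0 = (1/2) \<cdot>\<^sub>v F"
  define y where "y j = marginal_cost I s j (s j) / 2" for j
  have F: "F \<in> carrier_vec d" by (simp add: F_def)
  have Fv: "v0 \<bullet> v i j = 1/2 * (\<Sum>k\<in>{1..?n}. pair_cost I j k i (s k))"
    if "j \<in> players I" "i \<in> strategies I j" for i j
  proof -
    have "F \<bullet> v i j = (\<Sum>k\<in>{1..?n}. v (s k) k \<bullet> v i j)"
      unfolding F_def by (rule vec_sum_scalar_prod) (rule v)+
    also have "\<dots> = (\<Sum>k\<in>{1..?n}. pair_cost I j k i (s k))"
      using that s by (intro sum.cong refl) (simp add: ip pair_cost_commute[of I _ j] pl)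
    finally show ?thesis using F v[of i j] by (simp add: v0_def smult_scalar_prod_distrib)
  qed
  have feas_y: "y j \<le> own_cost I j i - 1/2 * (v i j \<bullet> v i j) + v0 \<bullet> v i j"
    if j: "j \<in> players I" and i: "i \<in> strategies I j" for i j
  proof -
    \<comment> \<open>The marginal cost involves only earlier players, whereas \<open>v0\<close>
      involves all of them; the extra terms, including the one for \<open>j\<close> itself, are
      nonnegative.\<close>
    have "(\<Sum>k\<in>{1..<j}. pair_cost I j k i (s k)) \<le> (\<Sum>k\<in>{1..?n}. pair_cost I j k i (s k))"
      using j by (intro sum_mono2 pair_cost_nonneg[OF I j _ i s]) (auto simp: pl)
    then show ?thesis
      using greedy_marginal_cost_le[OF I gr ch j i]
      by (simp add: y_def Fv[OF j i] ip[OF j j i i] marginal_cost_def own_cost_eq_pair_cost)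
  qed
  have "sdp_feasible I d y v0 v"
    unfolding sdp_feasible_def
  proof (intro conjI ballI impI)
    show "v0 \<in> carrier_vec d" using F by (simp add: v0_def)
    show "ereal (y j) \<le> (\<Sum>e\<in>i. ereal (weight I j) * ptime I e j)
          - ereal (1/2 * (v i j \<bullet> v i j)) + ereal (v0 \<bullet> v i j)"
      if "j \<in> players I" "i \<in> strategies I j" for i j
      using feas_y[OF that] by (simp add: own_cost_ereal[OF I that])
    show "ereal (v i j \<bullet> v i' k) \<le> (\<Sum>e\<in>i \<inter> i'. ereal (weight I j) * ereal (weight I k) *
        min (smith_ratio I e j) (smith_ratio I e k))"
      if "j \<in> players I" "k \<in> players I" "i \<in> strategies I j" "i' \<in> strategies I k" for i i' j k
      unfolding pair_cost_ereal[OF I that] ip[OF that] by simp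
  qed (rule v)
  moreover have "(\<Sum>j\<in>{1..?n}. marginal_cost I s j (s j)) / 4 \<le> sdp_objective I y v0"
  proof -
    define A where "A = (\<Sum>j\<in>{1..?n}. own_cost I j (s j))"
    define B where "B = (\<Sum>j\<in>{1..?n}. \<Sum>k\<in>{1..<j}. pair_cost I j k (s j) (s k))"
    have "F \<bullet> F = (\<Sum>j\<in>{1..?n}. v (s j) j \<bullet> v (s j) j) +
        2 * (\<Sum>j\<in>{1..?n}. \<Sum>k\<in>{1..<j}. v (s j) j \<bullet> v (s k) k)"
      unfolding F_def by (rule vec_sum_norm) (rule v)
    also have "(\<Sum>j\<in>{1..?n}. v (s j) j \<bullet> v (s j) j) = A"
      unfolding A_def using s by (intro sum.cong refl) (simp add: ip own_cost_eq_pair_cost pl)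
    also have "(\<Sum>j\<in>{1..?n}. \<Sum>k\<in>{1..<j}. v (s j) j \<bullet> v (s k) k) = B"
      unfolding B_def using s by (intro sum.cong refl ip) (auto simp: pl)
    finally have "F \<bullet> F = A + 2 * B" .
    moreover have A_nonneg: "0 \<le> A"
      unfolding A_def by (intro sum_nonneg own_cost_nonneg[OF I _ s]) (auto simp: pl)
    moreover have "v0 \<bullet> v0 = (F \<bullet> F) / 4"
      using F by (simp add: v0_def)
    moreover have "(\<Sum>j\<in>{1..?n}. y j) = (A + B) / 2"
      by (simp add: A_def B_def y_def marginal_cost_def sum.distrib flip: sum_divide_distrib)
    moreover have "(\<Sum>j\<in>{1..?n}. marginal_cost I s j (s j)) = A + B"
      by (simp add: A_def B_def marginal_cost_def sum.distrib)
    \<comment> \<open>The right side exceeds the left by \<open>A / 8\<close>.\<close>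
    moreover have "(A + B) / 4 \<le> (A + B) / 2 - 1/2 * ((A + 2 * B) / 4)"
      using A_nonneg by (simp add: field_simps)
    ultimately show ?thesis by (simp only: sdp_objective_def pl)
  qed
  ultimately show ?thesis
    using cost_upto_chooses[OF I ch] by (auto simp: cost_def)
qed

section \<open>Competitive ratio\<close>

lemma greedy_cost_le:
  assumes I: "valid_instance I" and gr: "greedy I x" and x': "pure_assignment I x'"
  shows "cost I x \<le> 4 * cost I x'"
proof -
  obtain d y v0 v where "sdp_feasible I d y v0 v" "cost I x / 4 \<le> ereal (sdp_objective I y v0)"
    using greedy_dual_solution[OF I gr] by blast
  then have "cost I x / 4 \<le> cost I x'"
    using sdp_weak_duality[OF I _ x'] order_trans by blast
  then show ?thesis
    by (cases "cost I x"; cases "cost I x'") auto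
qed

text \<open>The bound against every assignment passes to the infimum, so the optimum lies between a
  quarter of the cost of Greedy and that cost. It is therefore finite, and the division can be done
  in the reals.\<close>

lemma greedy_ratio_le:
  assumes I: "valid_instance I" and gr: "greedy I x"
  shows "cost I x / opt_cost I \<le> 4"
proof -
  have cost: "\<exists>c\<ge>0. cost I x' = ereal c" if x': "pure_assignment I x'" for x'
  proof -
    obtain s where ch: "chooses I (num_players I) s x'"
      using pure_assignment_chooses[OF I x'] by blast
    then have s: "s j \<in> strategies I j" if "j \<in> players I" for j
      using that by (simp add: chooses_def players_def)
    have "0 \<le> marginal_cost I s j (s j)" if "j \<in> players I" for j
      unfolding marginal_cost_def using that
      by (intro add_nonneg_nonneg sum_nonneg own_cost_nonneg[OF I _ s] pair_cost_nonneg[OF I _ _ s s])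
        (auto simp: players_def)
    then show ?thesis
      using cost_upto_chooses[OF I ch]
      by (auto simp: cost_def players_def intro!: sum_nonneg)
  qed
  have x: "pure_assignment I x" using gr by (simp add: greedy_def)
  obtain c where c: "0 \<le> c" "cost I x = ereal c" using cost[OF x] by blast
  have "ereal (c / 4) \<le> opt_cost I"
    unfolding opt_cost_def
  proof (rule INF_greatest)
    fix x' assume "x' \<in> {x. pure_assignment I x}"
    then show "ereal (c / 4) \<le> cost I x'"
      using greedy_cost_le[OF I gr, of x'] cost[of x'] c by auto
  qed
  moreover have "opt_cost I \<le> ereal c"
    unfolding opt_cost_def c(2)[symmetric] using x by (intro INF_lower) simp
  ultimately obtain q where q: "opt_cost I = ereal q" "c / 4 \<le> q"
    by (cases "opt_cost I") auto
  show ?thesis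
  proof (cases "q = 0")
    \<comment> \<open>An optimum of \<open>0\<close> forces \<open>c = 0\<close>, and
      \<open>0 / 0\<close> is \<open>0\<close>.\<close>
    case True
    then show ?thesis using c q by simp
  next
    case False
    then have "0 < q" using c q by simp
    then show ?thesis using c q by (simp add: field_simps)
  qed
qed

theorem theorem7p2:
  "(\<forall>(I :: 'e congestion_instance) x. valid_instance I \<and> greedy I x \<longrightarrow>
      (\<exists>d y v0 v. sdp_feasible I d y v0 v \<and> cost I x / 4 \<le> ereal (sdp_objective I y v0)) \<and>
      (\<forall>x'. pure_assignment I x' \<longrightarrow> cost I x \<le> 4 * cost I x')) \<and>
   greedy_competitive_ratio TYPE('e) \<le> 4"
proof (intro conjI allI impI)
  show "greedy_competitive_ratio TYPE('e) \<le> 4"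
    unfolding greedy_competitive_ratio_def by (rule Sup_least) (clarify, rule greedy_ratio_le)
qed (use greedy_dual_solution greedy_cost_le in auto)

end
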